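(* Consider the day-ahead market cleared by problem (RED) described in the context, with all quantities evaluated at its optimal solution and optimal Lagrange multipliers. If transmission reserves $\Delta f^{\mathrm{pos}}_{l,t}$ and $\Delta f^{\mathrm{neg}}_{l,t}$ are kept for line $l$ at time $t$, then the maximum FTR underfunding associated with line $l$ at time $t$, due to the deficiency of energy congestion cost, is $$\sum_{k\in\mathcal K}\left(\bar\eta^k_{l,t}\,\Delta f^{\mathrm{pos}}_{l,t}+\underline\eta^k_{l,t}\,\Delta f^{\mathrm{neg}}_{l,t}\right).$$ Here the maximum is over the FTR portfolios satisfying the simultaneous feasibility test, and FTR underfunding is the FTR credit minus the energy congestion cost.
   Context: Data. There are finitely many units $i$, buses $m$ ($N_D$ of them), lines $l$ and time intervals $t\in\{1,\dots,N_T\}$. $\mathcal G(m)$ is the set of units located at bus $m$ (each unit is at exactly one bus). Given are loads $d_{m,t}$, physical line flow limits $F_l\ge 0$, shift factors $\Gamma_{l,m}$, minimum and maximum outputs $P_i^{\min},P_i^{\max}$, ramping limits $r_i^u,r_i^d$ between sequential intervals, ramping limits $R_i^u,R_i^d$ for uncertainty accommodation, and initial outputs $P_{i,0}$. Network losses are ignored and the shift factors are constant. The generation cost functions $C_i^P$ are such that (RED) below is a convex linear program. Unit commitment variables are fixed at binary values $\hat I_{i,t}$ (on/off), $\hat y_{i,t}$ (start-up), $\hat z_{i,t}$ (shut-down). $\mathcal K$ is a finite index set and $\hat\epsilon^k\in\mathbb R^{N_DN_T}$, $k\in\mathcal K$, are given extreme points of the uncertainty set $\mathcal U=\{\epsilon:\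 -u_{m,t}\le\epsilon_{m,t}\le u_{m,t}\ \forall m,t;\ \sum_m|\epsilon_{m,t}|/u_{m,t}\le\Lambda^\Delta_t\ \forall t\}$, with given bounds $u_{m,t}$ and integer budgets $\Lambda^\Delta_t$. Problem (RED): minimize $\sum_t\sum_i C_i^P(P_{i,t})$ over $P_{i,t}$ and $\Delta P^k_{i,t}$ subject to the following constraints for all relevant indices (multiplier in parentheses), with $P^{\mathrm{inj}}_{m,t}:=\sum_{i\in\mathcal G(m)}P_{i,t}-d_{m,t}$ and $\Delta P^{\mathrm{inj},k}_{m,t}:=\sum_{i\in\mathcal G(m)}\Delta P^k_{i,t}-\hat\epsilon^k_{m,t}$: - $(\lambda_t)$ $\sum_iP_{i,t}=\sum_md_{m,t}$; - $(\bar\beta_{i,t})$ $P_{i,t}\le\hat I_{i,t}P_i^{\max}$; $(\underline\beta_{i,t})$ $-P_{i,t}\le-\hat I_{i,t}P_i^{\min}$; - $(\bar\alpha_{i,t})$ $P_{i,t}-P_{i,t-1}\le r_i^u(1-\hat y_{i,t})+P_i^{\min}\hat y_{i,t}$; $(\underline\alpha_{i,t})$ $-P_{i,t}+P_{i,t-1}\le r_i^d(1-\hat z_{i,t})+P_i^{\min}\hat z_{i,t}$; - $(\bar\eta_{l,t})$ $\sum_m\Gamma_{l,m}P^{\mathrm{inj}}_{m,t}\le F_l$; $(\underline\eta_{l,t})$ $-\sum_m\Gamma_{l,m}P^{\mathrm{inj}}_{m,t}\le F_l$; and for all $k\in\mathcal K$: - $(\lambda^k_t)$ $\sum_i\Delta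 P^k_{i,t}=\sum_m\hat\epsilon^k_{m,t}$; - $(\bar\beta^k_{i,t})$ $P_{i,t}+\Delta P^k_{i,t}\le\hat I_{i,t}P_i^{\max}$; $(\underline\beta^k_{i,t})$ $-P_{i,t}-\Delta P^k_{i,t}\le-\hat I_{i,t}P_i^{\min}$; - $(\bar\alpha^k_{i,t})$ $\Delta P^k_{i,t}\le R_i^u(1-\hat y_{i,t})$; $(\underline\alpha^k_{i,t})$ $-\Delta P^k_{i,t}\le R_i^d(1-\hat z_{i,t+1})$; - $(\bar\eta^k_{l,t})$ $\sum_m\Gamma_{l,m}(P^{\mathrm{inj}}_{m,t}+\Delta P^{\mathrm{inj},k}_{m,t})\le F_l$; $(\underline\eta^k_{l,t})$ $-\sum_m\Gamma_{l,m}(P^{\mathrm{inj}}_{m,t}+\Delta P^{\mathrm{inj},k}_{m,t})\le F_l$. The Lagrangian is the cost plus $\sum_t\lambda_t(\sum_md_{m,t}-\sum_iP_{i,t})$ plus $\sum_{k,t}\lambda^k_t(\sum_m\hat\epsilon^k_{m,t}-\sum_i\Delta P^k_{i,t})$ plus, for each inequality, its nonnegative multiplier times (left side minus right side). The multipliers are optimal (KKT) multipliers. Transmission reserves of line $l$ at time $t$ in the positive and negative directions: $\Delta f^{\mathrm{pos}}_{l,t}:=F_l-\sum_m\Gamma_{l,m}P^{\mathrm{inj}}_{m,t}$ and $\Delta f^{\mathrm{neg}}_{l,t}:=F_l+\sum_m\Gamma_{l,m}P^{\mathrm{inj}}_{m,t}$. Energy price (locational marginal price) at bus $m$ and time $t$: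 $\pi^e_{m,t}:=\lambda_t-\sum_l\Gamma_{l,m}(\bar\eta_{l,t}-\underline\eta_{l,t})-\sum_l\sum_{k\in\mathcal K}\Gamma_{l,m}(\bar\eta^k_{l,t}-\underline\eta^k_{l,t})$. Energy congestion cost at time $t$: the net payment of energy, $\sum_m(\pi^e_{m,t}d_{m,t}-\sum_{i\in\mathcal G(m)}\pi^e_{m,t}P_{i,t})$. In existing markets it funds the FTR credit. FTRs: a portfolio of financial transmission rights is a family of amounts $\mathrm{FTR}_{m\to n}$ from bus $m$ to bus $n$. It satisfies the simultaneous feasibility test, which uses the physical limits, if $-F_l\le\sum_{m\to n}(\Gamma_{l,m}-\Gamma_{l,n})\mathrm{FTR}_{m\to n}\le F_l$ for all lines $l$. The FTR credit at time $t$ is $\sum_{m\to n}(\pi^e_{m,t}-\pi^e_{n,t})\mathrm{FTR}_{m\to n}$. After substituting the formula for $\pi^e$ (and using $\sum_mP^{\mathrm{inj}}_{m,t}=0$), both the FTR credit and the energy congestion cost, and hence their difference, become sums over lines; the amount "associated with line $l$" is the term of that sum containing the multipliers $\bar\eta_{l,t},\underline\eta_{l,t},\bar\eta^k_{l,t},\underline\eta^k_{l,t}$ of line $l$.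
   Formalization: The stated value is proved to be an upper bound on the underfunding always, and to be its maximum exactly when F_l = 0 or the multipliers of line l at time t (base case and all k) are nonzero in at most one direction; without this condition the claimed maximum can fail. *)

theory Defs
  imports "HOL-Analysis.Analysis" "HOL-Analysis.Finite_Function_Topology"
begin

text \<open>
  Units, buses and lines are the elements of finite types, so that sums without an explicit range
  run over all of them. Time intervals are the numbers \<open>1..n_T\<close>, and the index set \<open>\<K>\<close> of the
  extreme points is a finite set \<open>scen\<close>. The status variables are given for all times; the only
  value beyond the horizon that the constraints use is \<open>shutdown i (n_T + 1)\<close>.
\<close>

record ('u, 'b, 'l, 'k) market =
  n_T :: nat
  bus :: "'u \<Rightarrow> 'b"
  load :: "'b \<Rightarrow> nat \<Rightarrow> real"
  F :: "'l \<Rightarrow> real"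
  \<Gamma> :: "'l \<Rightarrow> 'b \<Rightarrow> real"
  Pmin :: "'u \<Rightarrow> real"
  Pmax :: "'u \<Rightarrow> real"
  r_up :: "'u \<Rightarrow> real"
  r_dn :: "'u \<Rightarrow> real"
  R_up :: "'u \<Rightarrow> real"
  R_dn :: "'u \<Rightarrow> real"
  P_init :: "'u \<Rightarrow> real"
  gcost :: "'u \<Rightarrow> real \<Rightarrow> real"
  committed :: "'u \<Rightarrow> nat \<Rightarrow> bool"
  startup :: "'u \<Rightarrow> nat \<Rightarrow> bool"
  shutdown :: "'u \<Rightarrow> nat \<Rightarrow> bool"
  u_bound :: "'b \<Rightarrow> nat \<Rightarrow> real"
  budget :: "nat \<Rightarrow> int"
  scen :: "'k set"
  eps :: "'k \<Rightarrow> ('b \<times> nat) \<Rightarrow>\<^sub>0 real"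

text \<open>
  Elements of \<open>\<real>^(N_D N_T)\<close> are finitely supported functions on (bus, time) that vanish
  outside the horizon; this type is a real vector space, so that the library notion of an extreme
  point applies.
\<close>

definition uncertainty_set ::
    "('u, 'b::finite, 'l, 'k) market \<Rightarrow> (('b \<times> nat) \<Rightarrow>\<^sub>0 real) set" where
  "uncertainty_set D = {e. Poly_Mapping.keys e \<subseteq> UNIV \<times> {1..n_T D} \<and>
     (\<forall>m. \<forall>t\<in>{1..n_T D}. - u_bound D m t \<le> Poly_Mapping.lookup e (m, t) \<and>
                         Poly_Mapping.lookup e (m, t) \<le> u_bound D m t) \<and>
     (\<forall>t\<in>{1..n_T D}.
        (\<Sum>m\<in>UNIV. \<bar>Poly_Mapping.lookup e (m, t)\<bar> / u_bound D m t) \<le> of_int (budget D t))}"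

definition dev :: "('u, 'b, 'l, 'k) market \<Rightarrow> 'k \<Rightarrow> 'b \<Rightarrow> nat \<Rightarrow> real" where
  "dev D k m t = Poly_Mapping.lookup (eps D k) (m, t)"

text \<open>
  A maximum of finitely many affine functions; with such costs the minimization is a linear program
  (in epigraph form), and affine costs are a special case.
\<close>

definition convex_pw_linear :: "(real \<Rightarrow> real) \<Rightarrow> bool" where
  "convex_pw_linear c \<longleftrightarrow>
     (\<exists>A. finite A \<and> A \<noteq> {} \<and> (\<forall>p. c p = Max ((\<lambda>(a, b). a * p + b) ` A)))"

definition market_data :: "('u, 'b::finite, 'l, 'k) market \<Rightarrow> bool" where
  "market_data D \<longleftrightarrow>
     (\<forall>l. 0 \<le> F D l) \<and>
     (\<forall>i. convex_pw_linear (gcost D i)) \<and>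
     finite (scen D) \<and>
     (\<forall>k\<in>scen D. eps D k extreme_point_of uncertainty_set D)"

definition units_at :: "('u, 'b, 'l, 'k) market \<Rightarrow> 'b \<Rightarrow> 'u set" where
  "units_at D m = {i. bus D i = m}"

definition Pinj ::
    "('u::finite, 'b, 'l, 'k) market \<Rightarrow> ('u \<Rightarrow> nat \<Rightarrow> real) \<Rightarrow> 'b \<Rightarrow> nat \<Rightarrow> real" where
  "Pinj D P m t = (\<Sum>i\<in>units_at D m. P i t) - load D m t"

definition DPinj ::
    "('u::finite, 'b, 'l, 'k) market \<Rightarrow> ('k \<Rightarrow> 'u \<Rightarrow> nat \<Rightarrow> real) \<Rightarrow> 'k \<Rightarrow> 'b \<Rightarrow> nat \<Rightarrow> real" where
  "DPinj D dP k m t = (\<Sum>i\<in>units_at D m. dP k i t) - dev D k m t"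

definition flow ::
    "('u::finite, 'b::finite, 'l, 'k) market \<Rightarrow> ('u \<Rightarrow> nat \<Rightarrow> real) \<Rightarrow> 'l \<Rightarrow> nat \<Rightarrow> real" where
  "flow D P l t = (\<Sum>m\<in>UNIV. \<Gamma> D l m * Pinj D P m t)"

definition scen_flow ::
    "('u::finite, 'b::finite, 'l, 'k) market \<Rightarrow> ('u \<Rightarrow> nat \<Rightarrow> real) \<Rightarrow> ('k \<Rightarrow> 'u \<Rightarrow> nat \<Rightarrow> real) \<Rightarrow>
     'k \<Rightarrow> 'l \<Rightarrow> nat \<Rightarrow> real" where
  "scen_flow D P dP k l t = (\<Sum>m\<in>UNIV. \<Gamma> D l m * (Pinj D P m t + DPinj D dP k m t))"

text \<open>Only \<open>P i t\<close> with \<open>1 \<le> t \<le> n_T\<close> is a decision variable; the output at time 0 is given.\<close>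

definition P_prev :: "('u, 'b, 'l, 'k) market \<Rightarrow> ('u \<Rightarrow> nat \<Rightarrow> real) \<Rightarrow> 'u \<Rightarrow> nat \<Rightarrow> real" where
  "P_prev D P i t = (if t = 1 then P_init D i else P i (t - 1))"

text \<open>
  Left side minus right side of each inequality constraint; the constraint says that this is
  nonpositive. The names are those of the multipliers (\<open>hi\<close>: overlined, \<open>lo\<close>: underlined,
  final \<open>s\<close>: constraint of a scenario).
\<close>

definition g_\<beta>hi where
  "g_\<beta>hi D P i t = P i t - of_bool (committed D i t) * Pmax D i"
definition g_\<beta>lo where
  "g_\<beta>lo D P i t = - P i t + of_bool (committed D i t) * Pmin D i"
definition g_\<alpha>hi where
  "g_\<alpha>hi D P i t = P i t - P_prev D P i t
     - (r_up D i * (1 - of_bool (startup D i t)) + Pmin D i * of_bool (startup D i t))"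
definition g_\<alpha>lo where
  "g_\<alpha>lo D P i t = - P i t + P_prev D P i t
     - (r_dn D i * (1 - of_bool (shutdown D i t)) + Pmin D i * of_bool (shutdown D i t))"
definition g_\<eta>hi where
  "g_\<eta>hi D P l t = flow D P l t - F D l"
definition g_\<eta>lo where
  "g_\<eta>lo D P l t = - flow D P l t - F D l"
definition g_\<beta>his where
  "g_\<beta>his D P dP k i t = P i t + dP k i t - of_bool (committed D i t) * Pmax D i"
definition g_\<beta>los where
  "g_\<beta>los D P dP k i t = - P i t - dP k i t + of_bool (committed D i t) * Pmin D i"
definition g_\<alpha>his where
  "g_\<alpha>his D dP k i t = dP k i t - R_up D i * (1 - of_bool (startup D i t))"
definition g_\<alpha>los where
  "g_\<alpha>los D dP k i t = - dP k i t - R_dn D i * (1 - of_bool (shutdown D i (t + 1)))"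
definition g_\<eta>his where
  "g_\<eta>his D P dP k l t = scen_flow D P dP k l t - F D l"
definition g_\<eta>los where
  "g_\<eta>los D P dP k l t = - scen_flow D P dP k l t - F D l"

definition feasible ::
    "('u::finite, 'b::finite, 'l::finite, 'k) market \<Rightarrow> ('u \<Rightarrow> nat \<Rightarrow> real) \<Rightarrow>
     ('k \<Rightarrow> 'u \<Rightarrow> nat \<Rightarrow> real) \<Rightarrow> bool" where
  "feasible D P dP \<longleftrightarrow> (\<forall>t\<in>{1..n_T D}.
     (\<Sum>i\<in>UNIV. P i t) = (\<Sum>m\<in>UNIV. load D m t) \<and>
     (\<forall>i. g_\<beta>hi D P i t \<le> 0 \<and> g_\<beta>lo D P i t \<le> 0 \<and> g_\<alpha>hi D P i t \<le> 0 \<and> g_\<alpha>lo D P i t \<le> 0) \<and>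
     (\<forall>l. g_\<eta>hi D P l t \<le> 0 \<and> g_\<eta>lo D P l t \<le> 0) \<and>
     (\<forall>k\<in>scen D.
        (\<Sum>i\<in>UNIV. dP k i t) = (\<Sum>m\<in>UNIV. dev D k m t) \<and>
        (\<forall>i. g_\<beta>his D P dP k i t \<le> 0 \<and> g_\<beta>los D P dP k i t \<le> 0 \<and>
             g_\<alpha>his D dP k i t \<le> 0 \<and> g_\<alpha>los D dP k i t \<le> 0) \<and>
        (\<forall>l. g_\<eta>his D P dP k l t \<le> 0 \<and> g_\<eta>los D P dP k l t \<le> 0)))"

definition total_cost ::
    "('u::finite, 'b, 'l, 'k) market \<Rightarrow> ('u \<Rightarrow> nat \<Rightarrow> real) \<Rightarrow> real" where
  "total_cost D P = (\<Sum>t = 1..n_T D. \<Sum>i\<in>UNIV. gcost D i (P i t))"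

definition optimal_solution ::
    "('u::finite, 'b::finite, 'l::finite, 'k) market \<Rightarrow> ('u \<Rightarrow> nat \<Rightarrow> real) \<Rightarrow>
     ('k \<Rightarrow> 'u \<Rightarrow> nat \<Rightarrow> real) \<Rightarrow> bool" where
  "optimal_solution D P dP \<longleftrightarrow> feasible D P dP \<and>
     (\<forall>P' dP'. feasible D P' dP' \<longrightarrow> total_cost D P \<le> total_cost D P')"

record ('u, 'l, 'k) multipliers =
  lam :: "nat \<Rightarrow> real"
  \<beta>hi :: "'u \<Rightarrow> nat \<Rightarrow> real"
  \<beta>lo :: "'u \<Rightarrow> nat \<Rightarrow> real"
  \<alpha>hi :: "'u \<Rightarrow> nat \<Rightarrow> real"
  \<alpha>lo :: "'u \<Rightarrow> nat \<Rightarrow> real"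
  \<eta>hi :: "'l \<Rightarrow> nat \<Rightarrow> real"
  \<eta>lo :: "'l \<Rightarrow> nat \<Rightarrow> real"
  lam_s :: "'k \<Rightarrow> nat \<Rightarrow> real"
  \<beta>his :: "'k \<Rightarrow> 'u \<Rightarrow> nat \<Rightarrow> real"
  \<beta>los :: "'k \<Rightarrow> 'u \<Rightarrow> nat \<Rightarrow> real"
  \<alpha>his :: "'k \<Rightarrow> 'u \<Rightarrow> nat \<Rightarrow> real"
  \<alpha>los :: "'k \<Rightarrow> 'u \<Rightarrow> nat \<Rightarrow> real"
  \<eta>his :: "'k \<Rightarrow> 'l \<Rightarrow> nat \<Rightarrow> real"
  \<eta>los :: "'k \<Rightarrow> 'l \<Rightarrow> nat \<Rightarrow> real"

definition Lagrangian ::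
    "('u::finite, 'b::finite, 'l::finite, 'k) market \<Rightarrow> ('u, 'l, 'k) multipliers \<Rightarrow>
     ('u \<Rightarrow> nat \<Rightarrow> real) \<Rightarrow> ('k \<Rightarrow> 'u \<Rightarrow> nat \<Rightarrow> real) \<Rightarrow> real" where
  "Lagrangian D M P dP =
     total_cost D P
     + (\<Sum>t = 1..n_T D. lam M t * ((\<Sum>m\<in>UNIV. load D m t) - (\<Sum>i\<in>UNIV. P i t)))
     + (\<Sum>k\<in>scen D. \<Sum>t = 1..n_T D.
          lam_s M k t * ((\<Sum>m\<in>UNIV. dev D k m t) - (\<Sum>i\<in>UNIV. dP k i t)))
     + (\<Sum>t = 1..n_T D. \<Sum>i\<in>UNIV.
          \<beta>hi M i t * g_\<beta>hi D P i t + \<beta>lo M i t * g_\<beta>lo D P i t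
          + \<alpha>hi M i t * g_\<alpha>hi D P i t + \<alpha>lo M i t * g_\<alpha>lo D P i t)
     + (\<Sum>t = 1..n_T D. \<Sum>l\<in>UNIV. \<eta>hi M l t * g_\<eta>hi D P l t + \<eta>lo M l t * g_\<eta>lo D P l t)
     + (\<Sum>k\<in>scen D. \<Sum>t = 1..n_T D. \<Sum>i\<in>UNIV.
          \<beta>his M k i t * g_\<beta>his D P dP k i t + \<beta>los M k i t * g_\<beta>los D P dP k i t
          + \<alpha>his M k i t * g_\<alpha>his D dP k i t + \<alpha>los M k i t * g_\<alpha>los D dP k i t)
     + (\<Sum>k\<in>scen D. \<Sum>t = 1..n_T D. \<Sum>l\<in>UNIV.
          \<eta>his M k l t * g_\<eta>his D P dP k l t + \<eta>los M k l t * g_\<eta>los D P dP k l t)"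

definition dual_feasible :: "('u, 'b, 'l, 'k) market \<Rightarrow> ('u, 'l, 'k) multipliers \<Rightarrow> bool" where
  "dual_feasible D M \<longleftrightarrow> (\<forall>t\<in>{1..n_T D}.
     (\<forall>i. 0 \<le> \<beta>hi M i t \<and> 0 \<le> \<beta>lo M i t \<and> 0 \<le> \<alpha>hi M i t \<and> 0 \<le> \<alpha>lo M i t) \<and>
     (\<forall>l. 0 \<le> \<eta>hi M l t \<and> 0 \<le> \<eta>lo M l t) \<and>
     (\<forall>k\<in>scen D.
        (\<forall>i. 0 \<le> \<beta>his M k i t \<and> 0 \<le> \<beta>los M k i t \<and> 0 \<le> \<alpha>his M k i t \<and> 0 \<le> \<alpha>los M k i t) \<and>
        (\<forall>l. 0 \<le> \<eta>his M k l t \<and> 0 \<le> \<eta>los M k l t)))"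

definition compl_slack ::
    "('u::finite, 'b::finite, 'l::finite, 'k) market \<Rightarrow> ('u, 'l, 'k) multipliers \<Rightarrow>
     ('u \<Rightarrow> nat \<Rightarrow> real) \<Rightarrow> ('k \<Rightarrow> 'u \<Rightarrow> nat \<Rightarrow> real) \<Rightarrow> bool" where
  "compl_slack D M P dP \<longleftrightarrow> (\<forall>t\<in>{1..n_T D}.
     (\<forall>i. \<beta>hi M i t * g_\<beta>hi D P i t = 0 \<and> \<beta>lo M i t * g_\<beta>lo D P i t = 0 \<and>
          \<alpha>hi M i t * g_\<alpha>hi D P i t = 0 \<and> \<alpha>lo M i t * g_\<alpha>lo D P i t = 0) \<and>
     (\<forall>l. \<eta>hi M l t * g_\<eta>hi D P l t = 0 \<and> \<eta>lo M l t * g_\<eta>lo D P l t = 0) \<and>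
     (\<forall>k\<in>scen D.
        (\<forall>i. \<beta>his M k i t * g_\<beta>his D P dP k i t = 0 \<and> \<beta>los M k i t * g_\<beta>los D P dP k i t = 0 \<and>
             \<alpha>his M k i t * g_\<alpha>his D dP k i t = 0 \<and> \<alpha>los M k i t * g_\<alpha>los D dP k i t = 0) \<and>
        (\<forall>l. \<eta>his M k l t * g_\<eta>his D P dP k l t = 0 \<and> \<eta>los M k l t * g_\<eta>los D P dP k l t = 0)))"

text \<open>
  The costs need not be differentiable, so stationarity is \<open>0 \<in> \<partial>L\<close>, where \<open>\<partial>L\<close> is the
  subdifferential in the primal variables; the subgradient inequality for \<open>0\<close> is the last conjunct.
\<close>

definition KKT_multipliers ::
    "('u::finite, 'b::finite, 'l::finite, 'k) market \<Rightarrow> ('u \<Rightarrow> nat \<Rightarrow> real) \<Rightarrow>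
     ('k \<Rightarrow> 'u \<Rightarrow> nat \<Rightarrow> real) \<Rightarrow> ('u, 'l, 'k) multipliers \<Rightarrow> bool" where
  "KKT_multipliers D P dP M \<longleftrightarrow>
     feasible D P dP \<and> dual_feasible D M \<and> compl_slack D M P dP \<and>
     (\<forall>P' dP'. Lagrangian D M P dP \<le> Lagrangian D M P' dP')"

definition reserve_pos ::
    "('u::finite, 'b::finite, 'l, 'k) market \<Rightarrow> ('u \<Rightarrow> nat \<Rightarrow> real) \<Rightarrow> 'l \<Rightarrow> nat \<Rightarrow> real" where
  "reserve_pos D P l t = F D l - flow D P l t"

definition reserve_neg ::
    "('u::finite, 'b::finite, 'l, 'k) market \<Rightarrow> ('u \<Rightarrow> nat \<Rightarrow> real) \<Rightarrow> 'l \<Rightarrow> nat \<Rightarrow> real" where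
  "reserve_neg D P l t = F D l + flow D P l t"

definition energy_price ::
    "('u, 'b, 'l::finite, 'k) market \<Rightarrow> ('u, 'l, 'k) multipliers \<Rightarrow> 'b \<Rightarrow> nat \<Rightarrow> real" where
  "energy_price D M m t = lam M t
     - (\<Sum>l\<in>UNIV. \<Gamma> D l m * (\<eta>hi M l t - \<eta>lo M l t))
     - (\<Sum>l\<in>UNIV. \<Sum>k\<in>scen D. \<Gamma> D l m * (\<eta>his M k l t - \<eta>los M k l t))"

text \<open>The net payment, and the credit of a portfolio, at time \<open>t\<close> and at prices \<open>p\<close> of the buses.\<close>

definition net_payment ::
    "('u::finite, 'b::finite, 'l, 'k) market \<Rightarrow> ('u \<Rightarrow> nat \<Rightarrow> real) \<Rightarrow> ('b \<Rightarrow> real) \<Rightarrow> nat \<Rightarrow> real" where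
  "net_payment D P p t = (\<Sum>m\<in>UNIV. p m * load D m t - (\<Sum>i\<in>units_at D m. p m * P i t))"

definition portfolio_credit :: "('b::finite \<Rightarrow> 'b \<Rightarrow> real) \<Rightarrow> ('b \<Rightarrow> real) \<Rightarrow> real" where
  "portfolio_credit ftr p = (\<Sum>m\<in>UNIV. \<Sum>n\<in>UNIV. (p m - p n) * ftr m n)"

definition congestion_cost ::
    "('u::finite, 'b::finite, 'l::finite, 'k) market \<Rightarrow> ('u, 'l, 'k) multipliers \<Rightarrow>
     ('u \<Rightarrow> nat \<Rightarrow> real) \<Rightarrow> nat \<Rightarrow> real" where
  "congestion_cost D M P t = net_payment D P (\<lambda>m. energy_price D M m t) t"

definition SFT :: "('u, 'b::finite, 'l, 'k) market \<Rightarrow> ('b \<Rightarrow> 'b \<Rightarrow> real) \<Rightarrow> bool" where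
  "SFT D ftr \<longleftrightarrow> (\<forall>l. - F D l \<le> (\<Sum>m\<in>UNIV. \<Sum>n\<in>UNIV. (\<Gamma> D l m - \<Gamma> D l n) * ftr m n) \<and>
                     (\<Sum>m\<in>UNIV. \<Sum>n\<in>UNIV. (\<Gamma> D l m - \<Gamma> D l n) * ftr m n) \<le> F D l)"

definition FTR_credit ::
    "('u, 'b::finite, 'l::finite, 'k) market \<Rightarrow> ('u, 'l, 'k) multipliers \<Rightarrow>
     ('b \<Rightarrow> 'b \<Rightarrow> real) \<Rightarrow> nat \<Rightarrow> real" where
  "FTR_credit D M ftr t = portfolio_credit ftr (\<lambda>m. energy_price D M m t)"

definition FTR_underfunding ::
    "('u::finite, 'b::finite, 'l::finite, 'k) market \<Rightarrow> ('u, 'l, 'k) multipliers \<Rightarrow>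
     ('u \<Rightarrow> nat \<Rightarrow> real) \<Rightarrow> ('b \<Rightarrow> 'b \<Rightarrow> real) \<Rightarrow> nat \<Rightarrow> real" where
  "FTR_underfunding D M P ftr t = FTR_credit D M ftr t - congestion_cost D M P t"

text \<open>
  The part of the price with the multipliers of line \<open>l\<close>. Since \<open>net_payment\<close> and
  \<open>portfolio_credit\<close> are linear in the prices, replacing the price by this part singles out the
  term of line \<open>l\<close>; the lemmas below show that these terms add up to the full amounts.
\<close>

definition energy_price_line ::
    "('u, 'b, 'l, 'k) market \<Rightarrow> ('u, 'l, 'k) multipliers \<Rightarrow> 'l \<Rightarrow> 'b \<Rightarrow> nat \<Rightarrow> real" where
  "energy_price_line D M l m t =
     - \<Gamma> D l m * (\<eta>hi M l t - \<eta>lo M l t) - (\<Sum>k\<in>scen D. \<Gamma> D l m * (\<eta>his M k l t - \<eta>los M k l t))"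

definition congestion_cost_line ::
    "('u::finite, 'b::finite, 'l, 'k) market \<Rightarrow> ('u, 'l, 'k) multipliers \<Rightarrow>
     ('u \<Rightarrow> nat \<Rightarrow> real) \<Rightarrow> 'l \<Rightarrow> nat \<Rightarrow> real" where
  "congestion_cost_line D M P l t = net_payment D P (\<lambda>m. energy_price_line D M l m t) t"

definition FTR_credit_line ::
    "('u, 'b::finite, 'l, 'k) market \<Rightarrow> ('u, 'l, 'k) multipliers \<Rightarrow>
     ('b \<Rightarrow> 'b \<Rightarrow> real) \<Rightarrow> 'l \<Rightarrow> nat \<Rightarrow> real" where
  "FTR_credit_line D M ftr l t = portfolio_credit ftr (\<lambda>m. energy_price_line D M l m t)"

definition FTR_underfunding_line ::
    "('u::finite, 'b::finite, 'l, 'k) market \<Rightarrow> ('u, 'l, 'k) multipliers \<Rightarrow>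
     ('u \<Rightarrow> nat \<Rightarrow> real) \<Rightarrow> ('b \<Rightarrow> 'b \<Rightarrow> real) \<Rightarrow> 'l \<Rightarrow> nat \<Rightarrow> real" where
  "FTR_underfunding_line D M P ftr l t = FTR_credit_line D M ftr l t - congestion_cost_line D M P l t"

lemma energy_price_eq_sum_lines:
  "energy_price D M m t = lam M t + (\<Sum>l\<in>UNIV. energy_price_line D M l m t)"
  by (simp add: energy_price_def energy_price_line_def sum_subtractf sum_negf)

lemma sum_Pinj:
  fixes D :: "('u::finite, 'b::finite, 'l, 'k) market"
  shows "(\<Sum>m\<in>UNIV. Pinj D P m t) = (\<Sum>i\<in>UNIV. P i t) - (\<Sum>m\<in>UNIV. load D m t)"
  using sum.group[of "UNIV :: 'u set" "UNIV :: 'b set" "bus D" "\<lambda>i. P i t"]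
  by (simp add: Pinj_def units_at_def sum_subtractf)

lemma net_payment_eq: "net_payment D P p t = - (\<Sum>m\<in>UNIV. p m * Pinj D P m t)"
  by (simp add: net_payment_def Pinj_def sum_negf[symmetric] sum_distrib_left right_diff_distrib)

lemma FTR_credit_eq_sum_lines:
  "FTR_credit D M ftr t = (\<Sum>l\<in>UNIV. FTR_credit_line D M ftr l t)"
proof -
  have "FTR_credit D M ftr t = (\<Sum>m\<in>UNIV. \<Sum>n\<in>UNIV. \<Sum>l\<in>UNIV.
      (energy_price_line D M l m t - energy_price_line D M l n t) * ftr m n)"
    by (simp add: FTR_credit_def portfolio_credit_def energy_price_eq_sum_lines
        sum_subtractf[symmetric] sum_distrib_right)
  also have "\<dots> = (\<Sum>m\<in>UNIV. \<Sum>l\<in>UNIV. \<Sum>n\<in>UNIV.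
      (energy_price_line D M l m t - energy_price_line D M l n t) * ftr m n)"
    by (intro sum.cong refl sum.swap)
  also have "\<dots> = (\<Sum>l\<in>UNIV. FTR_credit_line D M ftr l t)"
    unfolding FTR_credit_line_def portfolio_credit_def by (rule sum.swap)
  finally show ?thesis .
qed

lemma congestion_cost_eq_sum_lines:
  assumes "(\<Sum>i\<in>UNIV. P i t) = (\<Sum>m\<in>UNIV. load D m t)"
  shows "congestion_cost D M P t = (\<Sum>l\<in>UNIV. congestion_cost_line D M P l t)"
proof -
  have "(\<Sum>m\<in>UNIV. energy_price D M m t * Pinj D P m t)
      = lam M t * (\<Sum>m\<in>UNIV. Pinj D P m t)
        + (\<Sum>m\<in>UNIV. \<Sum>l\<in>UNIV. energy_price_line D M l m t * Pinj D P m t)"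
    by (simp add: energy_price_eq_sum_lines distrib_right sum.distrib sum_distrib_left
        sum_distrib_right)
  also have "\<dots> = (\<Sum>l\<in>UNIV. \<Sum>m\<in>UNIV. energy_price_line D M l m t * Pinj D P m t)"
    using assms by (simp add: sum_Pinj sum.swap[of _ "UNIV :: 'c set"])
  finally show ?thesis
    by (simp add: congestion_cost_def congestion_cost_line_def net_payment_eq sum_negf)
qed

lemma FTR_underfunding_eq_sum_lines:
  assumes "feasible D P dP" "t \<in> {1..n_T D}"
  shows "FTR_underfunding D M P ftr t = (\<Sum>l\<in>UNIV. FTR_underfunding_line D M P ftr l t)"
proof -
  have "(\<Sum>i\<in>UNIV. P i t) = (\<Sum>m\<in>UNIV. load D m t)"
    using assms unfolding feasible_def by blast
  then show ?thesis
    by (simp add: FTR_underfunding_def FTR_underfunding_line_def FTR_credit_eq_sum_lines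
        congestion_cost_eq_sum_lines sum_subtractf)
qed

definition is_maximum :: "real \<Rightarrow> real set \<Rightarrow> bool" where
  "is_maximum x S \<longleftrightarrow> x \<in> S \<and> (\<forall>y\<in>S. y \<le> x)"

end

theory Submission
  imports Defs
begin

text \<open>
  Let \<open>a\<close> and \<open>b\<close> be the total multipliers of line \<open>l\<close> in the positive and the negative direction,
  and let \<open>\<phi>\<close> be the loading that a portfolio puts on \<open>l\<close>. Complementary slackness lets the
  base-case multipliers be added to the claimed bound for free, so that it exceeds the
  underfunding by exactly \<open>a (F + \<phi>) + b (F - \<phi>)\<close>, which the feasibility test makes nonnegative.
  It vanishes if and only if \<open>\<phi> = - F\<close> unless \<open>a = 0\<close>, and \<open>\<phi> = F\<close> unless \<open>b = 0\<close>. When only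
  one direction is priced, some base-case or scenario constraint with a positive multiplier binds,
  and the corresponding balanced injection, with its sign reversed, is a portfolio that passes the
  test on all lines and attains the required loading.
\<close>

definition ftr_flow :: "('u, 'b::finite, 'l, 'k) market \<Rightarrow> ('b \<Rightarrow> 'b \<Rightarrow> real) \<Rightarrow> 'l \<Rightarrow> real" where
  "ftr_flow D ftr l = (\<Sum>m\<in>UNIV. \<Sum>n\<in>UNIV. (\<Gamma> D l m - \<Gamma> D l n) * ftr m n)"

definition price_hi :: "('u, 'b, 'l, 'k) market \<Rightarrow> ('u, 'l, 'k) multipliers \<Rightarrow> 'l \<Rightarrow> nat \<Rightarrow> real" where
  "price_hi D M l t = \<eta>hi M l t + (\<Sum>k\<in>scen D. \<eta>his M k l t)"

definition price_lo :: "('u, 'b, 'l, 'k) market \<Rightarrow> ('u, 'l, 'k) multipliers \<Rightarrow> 'l \<Rightarrow> nat \<Rightarrow> real" where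
  "price_lo D M l t = \<eta>lo M l t + (\<Sum>k\<in>scen D. \<eta>los M k l t)"

lemma SFT_iff: "SFT D ftr \<longleftrightarrow> (\<forall>l. \<bar>ftr_flow D ftr l\<bar> \<le> F D l)"
  by (simp add: SFT_def ftr_flow_def abs_le_iff minus_le_iff conj_commute)

lemma energy_price_line_eq:
  "energy_price_line D M l m t = (price_lo D M l t - price_hi D M l t) * \<Gamma> D l m"
  by (simp add: energy_price_line_def price_hi_def price_lo_def sum_distrib_left[symmetric]
      sum_subtractf algebra_simps)

text \<open>The line part of the price is a multiple of \<open>\<Gamma> D l m\<close>, so the credit
  scales the loading of the portfolio and the congestion cost scales minus the flow of the dispatch.
  The portfolio therefore enters only through its loading of \<open>l\<close>.\<close>

lemma FTR_underfunding_line_eq: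
  "FTR_underfunding_line D M P ftr l t
     = (price_lo D M l t - price_hi D M l t) * (ftr_flow D ftr l + flow D P l t)"
  by (simp add: FTR_underfunding_line_def FTR_credit_line_def portfolio_credit_def
      congestion_cost_line_def net_payment_eq energy_price_line_eq ftr_flow_def flow_def
      right_diff_distrib[symmetric] sum_distrib_left distrib_left mult.assoc)

text \<open>All of the injection is routed to one arbitrary reference bus.\<close>

lemma ex_ftr_flow_eq:
  fixes D :: "('u, 'b::finite, 'l, 'k) market"
  assumes "(\<Sum>m\<in>UNIV. q m) = 0"
  shows "\<exists>ftr. \<forall>l. ftr_flow D ftr l = (\<Sum>m\<in>UNIV. \<Gamma> D l m * q m)"
proof (intro exI allI)
  fix l
  define r :: 'b where "r = undefined"
  \<comment> \<open>The right from \<open>r\<close> to itself carries coefficient zero and needs no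
    exception. The witness does not mention \<open>l\<close>, so one portfolio serves all
    lines.\<close>
  have "ftr_flow D (\<lambda>m n. if n = r then q m else 0) l = (\<Sum>m\<in>UNIV. (\<Gamma> D l m - \<Gamma> D l r) * q m)"
    by (simp add: ftr_flow_def if_distrib[of "\<lambda>x. _ * x"] cong: if_cong)
  also have "\<dots> = (\<Sum>m\<in>UNIV. \<Gamma> D l m * q m) - \<Gamma> D l r * (\<Sum>m\<in>UNIV. q m)"
    by (simp add: left_diff_distrib sum_subtractf sum_distrib_left)
  finally show "ftr_flow D (\<lambda>m n. if n = undefined then q m else 0) l = (\<Sum>m\<in>UNIV. \<Gamma> D l m * q m)"
    using assms by (simp add: r_def)
qed

text \<open>The feasibility test is symmetric in sign, so reversing an injection that respects the
  limits of all lines keeps it admissible. The reversal is needed because the multipliers of the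
  positive direction enter the price with a minus sign and so reward negative loading.\<close>

lemma SFT_attains:
  fixes D :: "('u, 'b::finite, 'l, 'k) market"
  assumes "(\<Sum>m\<in>UNIV. q m) = 0" and "\<And>l. \<bar>\<Sum>m\<in>UNIV. \<Gamma> D l m * q m\<bar> \<le> F D l"
  shows "\<exists>ftr. SFT D ftr \<and> ftr_flow D ftr l = - (\<Sum>m\<in>UNIV. \<Gamma> D l m * q m)"
proof -
  have "(\<Sum>m\<in>UNIV. - q m) = 0"
    using assms(1) by (simp add: sum_negf)
  from ex_ftr_flow_eq[OF this, of D]
  obtain ftr where "\<forall>l. ftr_flow D ftr l = - (\<Sum>m\<in>UNIV. \<Gamma> D l m * q m)"
    by (auto simp: sum_negf)
  moreover from this have "SFT D ftr"
    using assms(2) by (simp add: SFT_iff)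
  ultimately show ?thesis
    by blast
qed

lemma sum_DPinj:
  fixes D :: "('u::finite, 'b::finite, 'l, 'k) market"
  shows "(\<Sum>m\<in>UNIV. DPinj D dP k m t) = (\<Sum>i\<in>UNIV. dP k i t) - (\<Sum>m\<in>UNIV. dev D k m t)"
  using sum.group[of "UNIV :: 'u set" "UNIV :: 'b set" "bus D" "\<lambda>i. dP k i t"]
  by (simp add: DPinj_def units_at_def sum_subtractf)

lemma ex_SFT_flow:
  fixes D :: "('u::finite, 'b::finite, 'l::finite, 'k) market"
  assumes "feasible D P dP" and "t \<in> {1..n_T D}"
  shows "\<exists>ftr. SFT D ftr \<and> ftr_flow D ftr l = - flow D P l t"
  unfolding flow_def
proof (rule SFT_attains)
  show "(\<Sum>m\<in>UNIV. Pinj D P m t) = 0"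
    using assms by (simp add: sum_Pinj feasible_def)
  show "\<bar>\<Sum>m\<in>UNIV. \<Gamma> D l m * Pinj D P m t\<bar> \<le> F D l" for l
  proof -
    have "g_\<eta>hi D P l t \<le> 0" "g_\<eta>lo D P l t \<le> 0"
      using assms unfolding feasible_def by blast+
    then show ?thesis
      by (simp add: g_\<eta>hi_def g_\<eta>lo_def flow_def)
  qed
qed

text \<open>Scenario flows obey the same limits \<open>F\<close> as the test, and the redispatch
  balances the deviations, so a scenario injection serves as well as the base-case one.\<close>

lemma ex_SFT_scen_flow:
  fixes D :: "('u::finite, 'b::finite, 'l::finite, 'k) market"
  assumes "feasible D P dP" and "t \<in> {1..n_T D}" and "k \<in> scen D"
  shows "\<exists>ftr. SFT D ftr \<and> ftr_flow D ftr l = - scen_flow D P dP k l t"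
  unfolding scen_flow_def
proof (rule SFT_attains)
  show "(\<Sum>m\<in>UNIV. Pinj D P m t + DPinj D dP k m t) = 0"
    using assms by (simp add: sum.distrib sum_Pinj sum_DPinj feasible_def)
  show "\<bar>\<Sum>m\<in>UNIV. \<Gamma> D l m * (Pinj D P m t + DPinj D dP k m t)\<bar> \<le> F D l" for l
  proof -
    have "g_\<eta>his D P dP k l t \<le> 0" "g_\<eta>los D P dP k l t \<le> 0"
      using assms unfolding feasible_def by blast+
    then show ?thesis
      by (simp add: g_\<eta>his_def g_\<eta>los_def scen_flow_def)
  qed
qed

lemma KKT_line:
  assumes "KKT_multipliers D P dP M" and "t \<in> {1..n_T D}"
  shows "0 \<le> \<eta>hi M l t" "0 \<le> \<eta>lo M l t"
    and "\<eta>hi M l t * g_\<eta>hi D P l t = 0" "\<eta>lo M l t * g_\<eta>lo D P l t = 0"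
    and "k \<in> scen D \<Longrightarrow> 0 \<le> \<eta>his M k l t" "k \<in> scen D \<Longrightarrow> 0 \<le> \<eta>los M k l t"
    and "k \<in> scen D \<Longrightarrow> \<eta>his M k l t * g_\<eta>his D P dP k l t = 0"
    and "k \<in> scen D \<Longrightarrow> \<eta>los M k l t * g_\<eta>los D P dP k l t = 0"
  using assms unfolding KKT_multipliers_def dual_feasible_def compl_slack_def by blast+

lemma underfunding_gap:
  assumes "KKT_multipliers D P dP M" and "t \<in> {1..n_T D}"
  shows "(\<Sum>k\<in>scen D. \<eta>his M k l t * reserve_pos D P l t + \<eta>los M k l t * reserve_neg D P l t)
      - FTR_underfunding_line D M P ftr l t
    = price_hi D M l t * (F D l + ftr_flow D ftr l) + price_lo D M l t * (F D l - ftr_flow D ftr l)"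
    (is "?X - _ = _")
proof -
  have "\<eta>hi M l t * reserve_pos D P l t = 0" and "\<eta>lo M l t * reserve_neg D P l t = 0"
    using KKT_line(3,4)[OF assms, where l = l]
    by (auto simp: g_\<eta>hi_def g_\<eta>lo_def reserve_pos_def reserve_neg_def)
  then have "?X = price_hi D M l t * reserve_pos D P l t + price_lo D M l t * reserve_neg D P l t"
    unfolding price_hi_def price_lo_def
    by (simp only: sum.distrib sum_distrib_right distrib_right add_0_left)
  \<comment> \<open>The dispatch flow cancels between the reserves and the underfunding; only the
    loading of the portfolio remains.\<close>
  then show ?thesis
    unfolding FTR_underfunding_line_eq reserve_pos_def reserve_neg_def by argo
qed

text \<open>A sum of nonnegative multipliers vanishes only termwise. This yields a single priced
  constraint when a total is nonzero, and translates the totals back into the conditions of the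
  theorem.\<close>

lemma price_eq_0_iff:
  assumes "finite (scen D)" and "KKT_multipliers D P dP M" and "t \<in> {1..n_T D}"
  shows "price_hi D M l t = 0 \<longleftrightarrow> \<eta>hi M l t = 0 \<and> (\<forall>k\<in>scen D. \<eta>his M k l t = 0)"
    and "price_lo D M l t = 0 \<longleftrightarrow> \<eta>lo M l t = 0 \<and> (\<forall>k\<in>scen D. \<eta>los M k l t = 0)"
  using assms(1) KKT_line(1,2,5,6)[OF assms(2,3), where l = l]
  by (simp_all add: price_hi_def price_lo_def add_nonneg_eq_0_iff sum_nonneg sum_nonneg_eq_0_iff)

lemma ex_SFT_saturating:
  fixes D :: "('u::finite, 'b::finite, 'l::finite, 'k) market"
  assumes fin: "finite (scen D)" and kkt: "KKT_multipliers D P dP M" and t: "t \<in> {1..n_T D}"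
  shows "price_hi D M l t \<noteq> 0 \<Longrightarrow> \<exists>ftr. SFT D ftr \<and> ftr_flow D ftr l = - F D l"
    and "price_lo D M l t \<noteq> 0 \<Longrightarrow> \<exists>ftr. SFT D ftr \<and> ftr_flow D ftr l = F D l"
proof -
  have feas: "feasible D P dP"
    using kkt by (simp add: KKT_multipliers_def)
  note base = ex_SFT_flow[OF feas t, of l] and scenario = ex_SFT_scen_flow[OF feas t, of _ l]
  note slack = KKT_line(3,4,7,8)[OF kkt t, where l = l, unfolded g_\<eta>hi_def g_\<eta>lo_def g_\<eta>his_def g_\<eta>los_def]
  show "\<exists>ftr. SFT D ftr \<and> ftr_flow D ftr l = - F D l" if "price_hi D M l t \<noteq> 0"
  proof -
    from that price_eq_0_iff(1)[OF fin kkt t, of l]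
    consider "\<eta>hi M l t \<noteq> 0" | k where "k \<in> scen D" "\<eta>his M k l t \<noteq> 0" by blast
    then show ?thesis
    proof cases
      case 1
      then have "flow D P l t = F D l" using slack(1) by simp
      then show ?thesis using base by simp
    next
      case 2
      then have "scen_flow D P dP k l t = F D l" using slack(3)[of k] by simp
      then show ?thesis using scenario[OF 2(1)] by simp
    qed
  qed
  show "\<exists>ftr. SFT D ftr \<and> ftr_flow D ftr l = F D l" if "price_lo D M l t \<noteq> 0"
  proof -
    from that price_eq_0_iff(2)[OF fin kkt t, of l]
    consider "\<eta>lo M l t \<noteq> 0" | k where "k \<in> scen D" "\<eta>los M k l t \<noteq> 0" by blast
    then show ?thesis
    proof cases
      case 1
      then have "- flow D P l t = F D l" using slack(2) by simp
      then show ?thesis using base by simp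
    next
      case 2
      then have "- scen_flow D P dP k l t = F D l" using slack(4)[of k] by simp
      then show ?thesis using scenario[OF 2(1)] by simp
    qed
  qed
qed

text \<open>If both directions of a line are priced and its limit is positive, no single loading
  closes both gaps and the bound is strict. Hence attainment is characterized rather than
  asserted.\<close>

theorem theorem1:
  fixes D :: "('u::finite, 'b::finite, 'l::finite, 'k) market"
    and M :: "('u, 'l, 'k) multipliers"
    and P :: "'u \<Rightarrow> nat \<Rightarrow> real" and dP :: "'k \<Rightarrow> 'u \<Rightarrow> nat \<Rightarrow> real"
    and l :: 'l and t :: nat
  assumes "market_data D"
    and "optimal_solution D P dP"
    and "KKT_multipliers D P dP M"
    and "t \<in> {1..n_T D}"
  shows "let U = (\<lambda>ftr. FTR_underfunding_line D M P ftr l t) ` {ftr. SFT D ftr};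
             X = (\<Sum>k\<in>scen D. \<eta>his M k l t * reserve_pos D P l t + \<eta>los M k l t * reserve_neg D P l t)
         in (\<forall>y\<in>U. y \<le> X) \<and>
            (is_maximum X U \<longleftrightarrow>
               F D l = 0 \<or>
               (\<eta>hi M l t = 0 \<and> (\<forall>k\<in>scen D. \<eta>his M k l t = 0)) \<or>
               (\<eta>lo M l t = 0 \<and> (\<forall>k\<in>scen D. \<eta>los M k l t = 0)))"
proof -
  define U where "U = (\<lambda>ftr. FTR_underfunding_line D M P ftr l t) ` {ftr. SFT D ftr}"
  define X where
    "X = (\<Sum>k\<in>scen D. \<eta>his M k l t * reserve_pos D P l t + \<eta>los M k l t * reserve_neg D P l t)"
  define a where "a = price_hi D M l t"
  define b where "b = price_lo D M l t"
  have fin: "finite (scen D)" and F_nonneg: "0 \<le> F D l" for l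
    using assms(1) by (auto simp: market_data_def)
  have nonneg: "0 \<le> a" "0 \<le> b"
    using KKT_line(1,2,5,6)[OF assms(3,4), where l = l]
    by (simp_all add: a_def b_def price_hi_def price_lo_def sum_nonneg)
  have gap: "X - FTR_underfunding_line D M P ftr l t
      = a * (F D l + ftr_flow D ftr l) + b * (F D l - ftr_flow D ftr l)" for ftr
    unfolding X_def a_def b_def by (rule underfunding_gap[OF assms(3,4)])
  have loading: "0 \<le> F D l + ftr_flow D ftr l" "0 \<le> F D l - ftr_flow D ftr l" if "SFT D ftr" for ftr
    using that by (auto simp: SFT_iff abs_le_iff dest!: spec[of _ l])
  have bound: "\<forall>y\<in>U. y \<le> X"
  proof
    fix y assume "y \<in> U"
    then obtain ftr where ftr: "SFT D ftr" "y = FTR_underfunding_line D M P ftr l t"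
      by (auto simp: U_def)
    have "0 \<le> a * (F D l + ftr_flow D ftr l) + b * (F D l - ftr_flow D ftr l)"
      using nonneg loading[OF ftr(1)] by simp
    then show "y \<le> X"
      using gap[of ftr] ftr(2) by simp
  qed
  have attained: "X \<in> U \<longleftrightarrow> (\<exists>ftr. SFT D ftr \<and>
      a * (F D l + ftr_flow D ftr l) = 0 \<and> b * (F D l - ftr_flow D ftr l) = 0)"
  proof -
    have "FTR_underfunding_line D M P ftr l t = X \<longleftrightarrow>
        a * (F D l + ftr_flow D ftr l) = 0 \<and> b * (F D l - ftr_flow D ftr l) = 0"
      if "SFT D ftr" for ftr
    proof -
      have "0 \<le> a * (F D l + ftr_flow D ftr l)" "0 \<le> b * (F D l - ftr_flow D ftr l)"
        using nonneg loading[OF that] by simp_all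
      then show ?thesis
        using gap[of ftr] by linarith
    qed
    then show ?thesis
      by (auto simp: U_def image_iff)
  qed
  have "X \<in> U \<longleftrightarrow> F D l = 0 \<or> a = 0 \<or> b = 0"
  proof
    assume "X \<in> U"
    \<comment> \<open>With \<open>a\<close> and \<open>b\<close> both nonzero the loading equals
      both \<open>- F D l\<close> and \<open>F D l\<close>, which forces the limit to be
      zero.\<close>
    then show "F D l = 0 \<or> a = 0 \<or> b = 0"
      unfolding attained by auto
  next
    assume degenerate: "F D l = 0 \<or> a = 0 \<or> b = 0"
    \<comment> \<open>The zero portfolio covers the cases in which no priced constraint need exist:
      with a zero limit its loading is already extremal, and with both totals zero any loading
      works.\<close>
    have zero: "SFT D (\<lambda>m n. 0)" "ftr_flow D (\<lambda>m n. 0) l = 0"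
      using F_nonneg by (simp_all add: SFT_iff ftr_flow_def)
    consider "F D l = 0 \<or> a = 0 \<and> b = 0" | "a \<noteq> 0" "b = 0" | "a = 0" "b \<noteq> 0"
      using degenerate by blast
    then show "X \<in> U"
    proof cases
      case 1
      then show ?thesis
        unfolding attained using zero by auto
    next
      case 2
      then show ?thesis
        unfolding attained
        using ex_SFT_saturating(1)[OF fin assms(3,4), of l] by (auto simp: a_def)
    next
      case 3
      then show ?thesis
        unfolding attained
        using ex_SFT_saturating(2)[OF fin assms(3,4), of l] by (auto simp: b_def)
    qed
  qed
  then show ?thesis
    using bound price_eq_0_iff[OF fin assms(3,4), of l]
    by (simp add: is_maximum_def U_def X_def a_def b_def Let_def)
qed

end
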